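(* Let $K,C$ be convex bodies in $\mathbb{R}^n$ with $K\subset\operatorname{int}C$. For every $\varepsilon>0$ there exist an $m\in\mathbb{N}$ and a convex body $K_m\subset C$ such that $K_m$ is uniquely determined by its geometric moments up to order $m$ among all convex bodies contained in $C$ (that is, every convex body $L\subset C$ with $\mu_\alpha(L)=\mu_\alpha(K_m)$ for all $\alpha\in\mathbb{N}_0^n$ with $|\alpha|\le m$ satisfies $L=K_m$), and \[\delta_H(K,K_m)\le\varepsilon.\]
   Context: A convex body is a compact, convex subset of $\mathbb{R}^n$ with nonempty interior; $\operatorname{int}$ denotes the interior; $\delta_H$ is the Hausdorff metric. For a compact set $K\subset\mathbb{R}^n$ and $\alpha\in\mathbb{N}_0^n$, the geometric moment of order $|\alpha|=\alpha_1+\dots+\alpha_n$ is $\mu_\alpha(K)=\int_K x_1^{\alpha_1}\cdots x_n^{\alpha_n}\,dx$. *)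

theory Defs
  imports "HOL-Analysis.Analysis"
begin

definition convex_body :: "(real ^ 'n) set \<Rightarrow> bool" where
  "convex_body K \<longleftrightarrow> compact K \<and> convex K \<and> interior K \<noteq> {}"

(* The suprema are taken in the conditionally complete type real, so this is the
   Hausdorff metric only for nonempty bounded sets (in particular for convex bodies). *)
definition hausdorff_dist :: "'a::metric_space set \<Rightarrow> 'a set \<Rightarrow> real" where
  "hausdorff_dist A B = max (SUP x\<in>A. infdist x B) (SUP y\<in>B. infdist y A)"

(* A multi-index in N_0^n is a function from the coordinate type to nat. The integrand is
   continuous, hence integrable over compact K; elsewhere the integral may default to 0. *)
definition geom_moment :: "('n::finite \<Rightarrow> nat) \<Rightarrow> (real ^ 'n) set \<Rightarrow> real" where
  "geom_moment \<alpha> K = (LINT x:K|lborel. (\<Prod>i\<in>UNIV. (x $ i) ^ \<alpha> i))"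

definition determined_by_moments ::
  "nat \<Rightarrow> (real ^ 'n::finite) set \<Rightarrow> (real ^ 'n) set \<Rightarrow> bool" where
  "determined_by_moments m C M \<longleftrightarrow>
     (\<forall>L. convex_body L \<and> L \<subseteq> C \<and>
          (\<forall>\<alpha>. (\<Sum>i\<in>UNIV. \<alpha> i) \<le> m \<longrightarrow> geom_moment \<alpha> L = geom_moment \<alpha> M)
        \<longrightarrow> L = M)"

end

theory Submission
  imports Defs
begin

text \<open>
  Integrating \<open>g\<close> over a subset \<open>L\<close> of \<open>C\<close> gives at most its integral over
  \<open>M = {x \<in> C. g x \<ge> 0}\<close>, with equality only if \<open>L\<close> and \<open>M\<close> agree up to a null set and the
  zeros of \<open>g\<close>. If \<open>g\<close> is a polynomial of degree at most \<open>m\<close>, the integral is a combination of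
  moments up to order \<open>m\<close>, and if moreover \<open>g\<close> is concave on \<open>C\<close>, this forces convex bodies to
  coincide. To approximate \<open>K\<close> by such sets \<open>M\<close>, choose by compactness finitely many affine
  functions that are nonnegative on \<open>C\<close>, at most 1 on \<open>K\<close>, and such that at every point of \<open>C\<close>
  at distance at least \<open>\<epsilon>\<close> from \<open>K\<close> one of them is at least \<open>1 + \<delta>\<close>. The sum \<open>q\<close> of their
  \<open>m\<close>-th powers is convex on \<open>C\<close>, and for large \<open>m\<close> the set \<open>{x \<in> C. q x \<le> k + 1}\<close>, where
  \<open>k\<close> is the number of functions, lies between \<open>K\<close> and its \<open>\<epsilon>\<close>-neighbourhood.
\<close>

section \<open>Polynomials and moments\<close>

text \<open>Polynomials are encoded as functions, through the linear span of the monomials of degree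
  at most \<open>m\<close>. A linear statement about them then follows by rule induction, with the
  moments as its base case.\<close>

inductive poly_deg_le :: "nat \<Rightarrow> (real ^ 'n::finite \<Rightarrow> real) \<Rightarrow> bool" for m where
  monom: "(\<Sum>i\<in>UNIV. \<alpha> i) \<le> m \<Longrightarrow> poly_deg_le m (\<lambda>x. \<Prod>i\<in>UNIV. (x $ i) ^ \<alpha> i)"
| cmul: "poly_deg_le m f \<Longrightarrow> poly_deg_le m (\<lambda>x. c * f x)"
| add: "poly_deg_le m f \<Longrightarrow> poly_deg_le m g \<Longrightarrow> poly_deg_le m (\<lambda>x. f x + g x)"

lemma poly_deg_le_const: "poly_deg_le m (\<lambda>x. c)"
  using poly_deg_le.cmul[OF poly_deg_le.monom[of "\<lambda>_. 0" m], of c] by simp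

lemma poly_deg_le_diff:
  assumes "poly_deg_le m f" "poly_deg_le m g"
  shows "poly_deg_le m (\<lambda>x. f x - g x)"
  using poly_deg_le.add[OF assms(1) poly_deg_le.cmul[OF assms(2), of "-1"]] by simp

lemma poly_deg_le_sum:
  assumes "finite A" "\<And>a. a \<in> A \<Longrightarrow> poly_deg_le m (f a)"
  shows "poly_deg_le m (\<lambda>x. \<Sum>a\<in>A. f a x)"
  using assms by (induction A rule: finite_induct)
    (auto intro: poly_deg_le_const poly_deg_le.add)

lemma poly_deg_le_Suc: "poly_deg_le m f \<Longrightarrow> poly_deg_le (Suc m) f"
  by (induction rule: poly_deg_le.induct) (auto intro: poly_deg_le.intros)

lemma poly_deg_le_mult_component:
  fixes f :: "real ^ 'n \<Rightarrow> real"
  assumes "poly_deg_le m f"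
  shows "poly_deg_le (Suc m) (\<lambda>x. x $ j * f x)"
  using assms
proof induction
  case (monom \<alpha>)
  let ?\<beta> = "\<alpha>(j := Suc (\<alpha> j))"
  have "(\<Sum>i\<in>UNIV. ?\<beta> i) = Suc (\<Sum>i\<in>UNIV. \<alpha> i)"
    by (simp add: sum.remove[of UNIV j])
  then have "poly_deg_le (Suc m) (\<lambda>x. \<Prod>i\<in>UNIV. (x $ i) ^ ?\<beta> i)"
    using monom by (intro poly_deg_le.monom) simp
  moreover have "(\<Prod>i\<in>UNIV. (x $ i) ^ ?\<beta> i) = x $ j * (\<Prod>i\<in>UNIV. (x $ i) ^ \<alpha> i)"
    for x :: "real ^ 'n"
    by (simp add: prod.remove[of UNIV j])
  ultimately show ?case by simp
next
  case (cmul f c)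
  then show ?case
    using poly_deg_le.cmul[OF cmul.IH, of c] by (simp add: mult.left_commute)
next
  case (add f g)
  then show ?case
    using poly_deg_le.add[OF add.IH] by (simp add: distrib_left)
qed

text \<open>Expanding the inner product in coordinates reduces this to multiplication by a single
  coordinate, which raises the degree by one.\<close>

lemma poly_deg_le_mult_affine:
  fixes u :: "real ^ 'n"
  assumes "poly_deg_le m f"
  shows "poly_deg_le (Suc m) (\<lambda>x. (u \<bullet> x + v) * f x)"
proof -
  have "poly_deg_le (Suc m) (\<lambda>x. (\<Sum>j\<in>UNIV. u $ j * (x $ j * f x)) + v * f x)"
    by (intro poly_deg_le.add poly_deg_le_sum poly_deg_le.cmul poly_deg_le_mult_component
        poly_deg_le_Suc assms) simp
  moreover have "(\<Sum>j\<in>UNIV. u $ j * (x $ j * f x)) + v * f x = (u \<bullet> x + v) * f x" for x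
    by (simp add: inner_vec_def sum_distrib_right distrib_right mult.assoc)
  ultimately show ?thesis by simp
qed

lemma poly_deg_le_affine_power: "poly_deg_le m (\<lambda>x. (u \<bullet> x + v) ^ m)"
proof (induction m)
  case 0
  then show ?case by (simp add: poly_deg_le_const)
next
  case (Suc m)
  then show ?case using poly_deg_le_mult_affine by fastforce
qed

lemma poly_deg_le_continuous: "poly_deg_le m f \<Longrightarrow> continuous_on S f"
  by (induction rule: poly_deg_le.induct) (auto intro!: continuous_intros)

lemma set_integrable_poly:
  assumes "compact S" "poly_deg_le m f"
  shows "set_integrable lborel S f"
  unfolding set_integrable_def
  using assms by (intro borel_integrable_compact poly_deg_le_continuous)

text \<open>Both sides are linear in \<open>f\<close> and agree on monomials by hypothesis;
  compactness of \<open>L\<close> and \<open>M\<close> gives the integrability that additivity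
  needs.\<close>

lemma moments_determine_poly_integral:
  assumes "poly_deg_le m f" "compact L" "compact M"
    and "\<And>\<alpha>. (\<Sum>i\<in>UNIV. \<alpha> i) \<le> m \<Longrightarrow> geom_moment \<alpha> L = geom_moment \<alpha> M"
  shows "(LINT x:L|lborel. f x) = (LINT x:M|lborel. f x)"
  using assms(1)
proof induction
  case (monom \<alpha>)
  then show ?case using assms(4) by (simp add: geom_moment_def)
next
  case (cmul f c)
  then show ?case by simp
next
  case (add f g)
  then show ?case
    by (simp add: set_integral_add(2) set_integrable_poly[OF assms(2)]
        set_integrable_poly[OF assms(3)])
qed

section \<open>Superlevel sets of concave polynomials\<close>

text \<open>The difference of the two integrands is nonnegative everywhere: on the superlevel set
  outside \<open>L\<close> it is \<open>g\<close>, and on \<open>L\<close> outside the superlevel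
  set it is \<open>- g\<close>, where \<open>g\<close> is negative because L \<subseteq> C. Having
  integral zero, it vanishes almost everywhere.\<close>

lemma set_integral_superlevel_eq_imp_AE:
  fixes g :: "'a \<Rightarrow> real"
  assumes "set_integrable N {x\<in>C. 0 \<le> g x} g" "set_integrable N L g" "L \<subseteq> C"
    and "(LINT x:L|N. g x) = (LINT x:{x\<in>C. 0 \<le> g x}|N. g x)"
  shows "AE x in N. (indicator {x\<in>C. 0 \<le> g x} x - indicator L x) * g x = 0"
proof -
  let ?M = "{x\<in>C. 0 \<le> g x}"
  let ?f = "\<lambda>x. indicat_real ?M x *\<^sub>R g x - indicat_real L x *\<^sub>R g x"
  have int: "integrable N ?f"
    using assms(1,2) unfolding set_integrable_def by (rule Bochner_Integration.integrable_diff)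
  have "integral\<^sup>L N ?f = 0"
    using assms(1,2,4) unfolding set_integrable_def set_lebesgue_integral_def
    by (subst Bochner_Integration.integral_diff) auto
  moreover have "0 \<le> ?f x" for x
    using assms(3) by (auto simp: indicator_def)
  ultimately have "AE x in N. ?f x = 0"
    using integral_nonneg_eq_0_iff_AE[OF int] by simp
  then show ?thesis by (simp add: left_diff_distrib)
qed

text \<open>Nonempty open sets have positive Lebesgue measure. This is what turns almost-everywhere
  information into inclusions of sets.\<close>

lemma AE_lborel_open_empty:
  fixes U :: "'a::euclidean_space set"
  assumes "open U" "AE x in lborel. x \<notin> U"
  shows "U = {}"
proof -
  have "U \<in> null_sets lborel"
    using assms by (simp add: AE_iff_null_sets)
  then have "negligible U"
    using negligible_iff_null_sets null_sets_completionI by blast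
  then show ?thesis using assms(1) open_not_negligible by blast
qed

lemma convex_superlevel:
  assumes "concave_on C g"
  shows "convex {x\<in>C. c \<le> g x}"
proof (rule convexI)
  fix x y and a b :: real
  assume ab: "0 \<le> a" "0 \<le> b" "a + b = 1" and xy: "x \<in> {x\<in>C. c \<le> g x}" "y \<in> {x\<in>C. c \<le> g x}"
  have "convex C"
    using assms convex_on_imp_convex unfolding concave_on_def by blast
  then have "a *\<^sub>R x + b *\<^sub>R y \<in> C"
    using ab xy by (auto dest: convexD)
  moreover have "c \<le> g (a *\<^sub>R x + b *\<^sub>R y)"
    using convex_lower[OF assms[unfolded concave_on_def], of x y a b] ab xy by auto
  ultimately show "a *\<^sub>R x + b *\<^sub>R y \<in> {x\<in>C. c \<le> g x}" by simp
qed

text \<open>Moving a point of the superlevel set slightly towards \<open>x0\<close> brings it into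
  the interior and, by concavity, makes \<open>g\<close> positive. Every point is thus a limit of
  points of \<open>L\<close>.\<close>

lemma superlevel_subset_closed:
  fixes g :: "'a::euclidean_space \<Rightarrow> real"
  assumes g: "concave_on C g" and "closed L"
    and x0: "x0 \<in> interior {x\<in>C. 0 \<le> g x}" "0 < g x0"
    and sub: "interior {x\<in>C. 0 \<le> g x} \<inter> {x. 0 < g x} \<subseteq> L"
  shows "{x\<in>C. 0 \<le> g x} \<subseteq> L"
proof
  let ?M = "{x\<in>C. 0 \<le> g x}"
  fix x assume x: "x \<in> ?M"
  define y where "y n = x - (1 / real (Suc n)) *\<^sub>R (x - x0)" for n
  have "y n \<in> L" for n
  proof -
    define t where "t = 1 / real (Suc n)"
    have t: "0 < t" "t \<le> 1" by (auto simp: t_def)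
    have "y n \<in> interior ?M"
      unfolding y_def t_def[symmetric]
      by (rule mem_interior_convex_shrink[OF convex_superlevel[OF g] x0(1) x t])
    moreover have "0 < g (y n)"
    proof -
      have "x0 \<in> C" using x0(1) interior_subset by blast
      then have "(1 - t) * g x + t * g x0 \<le> g ((1 - t) *\<^sub>R x + t *\<^sub>R x0)"
        using convex_onD[OF g[unfolded concave_on_def], of t x x0] t x by simp
      also have "(1 - t) *\<^sub>R x + t *\<^sub>R x0 = y n"
        unfolding y_def t_def[symmetric] by (simp add: algebra_simps)
      finally have "(1 - t) * g x + t * g x0 \<le> g (y n)" .
      moreover have "0 \<le> (1 - t) * g x" "0 < t * g x0"
        using t x x0(2) by auto
      ultimately show ?thesis by linarith
    qed
    ultimately show ?thesis using sub by blast
  qed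
  moreover have "y \<longlonglongrightarrow> x"
  proof -
    have "y \<longlonglongrightarrow> x - 0 *\<^sub>R (x - x0)"
      unfolding y_def using LIMSEQ_inverse_real_of_nat
      by (intro tendsto_intros) (simp add: inverse_eq_divide)
    then show ?thesis by simp
  qed
  ultimately show "x \<in> L" using \<open>closed L\<close> closed_sequentially by blast
qed

lemma convex_body_superlevel:
  assumes "convex_body C" "concave_on C g" "continuous_on C g" "interior {x\<in>C. 0 \<le> g x} \<noteq> {}"
  shows "convex_body {x\<in>C. 0 \<le> g x}"
proof -
  have "closed {x\<in>C. 0 \<le> g x}"
    using assms(1,3) by (intro continuous_on_closed_Collect_le)
      (auto simp: convex_body_def compact_imp_closed)
  moreover have "bounded {x\<in>C. 0 \<le> g x}"
    using assms(1) by (auto simp: convex_body_def intro: bounded_subset compact_imp_bounded)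
  ultimately show ?thesis
    using assms convex_superlevel by (auto simp: convex_body_def compact_eq_bounded_closed)
qed

text \<open>Equal moments give equal integrals of \<open>g\<close>. Each of the two inclusions then
  comes from an open set that is null and therefore empty.\<close>

lemma superlevel_determined_by_moments:
  fixes g :: "real ^ 'n \<Rightarrow> real"
  assumes C: "convex_body C" and g: "poly_deg_le m g" "concave_on C g"
    and x0: "x0 \<in> interior {x\<in>C. 0 \<le> g x}" "0 < g x0"
  shows "determined_by_moments m C {x\<in>C. 0 \<le> g x}"
  unfolding determined_by_moments_def
proof (intro allI impI, elim conjE)
  let ?M = "{x\<in>C. 0 \<le> g x}"
  fix L
  assume L: "convex_body L" "L \<subseteq> C"
    and mom: "\<forall>\<alpha>. (\<Sum>i\<in>UNIV. \<alpha> i) \<le> m \<longrightarrow> geom_moment \<alpha> L = geom_moment \<alpha> ?M"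
  have cont: "continuous_on S g" for S
    using g(1) by (rule poly_deg_le_continuous)
  have M: "convex_body ?M"
    using convex_body_superlevel[OF C g(2) cont] x0(1) by blast
  have comp: "compact L" "compact ?M" and closed: "closed L" "closed ?M"
    using L(1) M by (auto simp: convex_body_def compact_imp_closed)
  have AE: "AE x in lborel. (indicator ?M x - indicator L x) * g x = 0"
    using comp g(1) L(2) mom
    by (intro set_integral_superlevel_eq_imp_AE set_integrable_poly
        moments_determine_poly_integral) auto
  have "open {x. 0 < g x}"
    using cont by (intro open_Collect_less) auto
  then have "open (interior ?M \<inter> {x. 0 < g x} - L)"
    using closed(1) by auto
  \<comment> \<open>Here the difference of indicators is 1 and \<open>g\<close> is positive, so the
    product cannot vanish.\<close>
  moreover have "AE x in lborel. x \<notin> interior ?M \<inter> {x. 0 < g x} - L"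
    using AE by eventually_elim (use interior_subset[of ?M] in \<open>auto simp: indicator_def\<close>)
  ultimately have "interior ?M \<inter> {x. 0 < g x} - L = {}"
    by (rule AE_lborel_open_empty)
  then have M_sub_L: "?M \<subseteq> L"
    by (intro superlevel_subset_closed[OF g(2) closed(1) x0]) blast
  \<comment> \<open>A point of \<open>L\<close> outside \<open>?M\<close> lies in \<open>C\<close>,
    so \<open>g\<close> is negative there and the product is again nonzero.\<close>
  have "AE x in lborel. x \<notin> interior L - ?M"
    using AE by eventually_elim
      (use interior_subset[of L] L(2) in \<open>auto simp: indicator_def split: if_splits\<close>)
  then have "interior L - ?M = {}"
    using closed(2) by (intro AE_lborel_open_empty) auto
  then have "closure (interior L) \<subseteq> ?M"
    using closed(2) by (intro closure_minimal) auto
  \<comment> \<open>Convexity and nonempty interior carry the inclusion from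
    \<open>interior L\<close> over to \<open>L\<close>, excluding lower-dimensional pieces.\<close>
  moreover have "L \<subseteq> closure (interior L)"
    using L(1) closure_subset by (auto simp: convex_body_def convex_closure_interior)
  ultimately show "L = ?M" using M_sub_L by blast
qed

section \<open>Approximation\<close>

text \<open>A strictly separating hyperplane is rescaled so that the affine function has value 1 on
  it and varies too little over \<open>C\<close> to become negative.\<close>

lemma affine_separation:
  fixes x :: "'a::euclidean_space"
  assumes "convex K" "compact K" "x \<notin> K" "bounded C"
  obtains u v where "\<And>y. y \<in> C \<Longrightarrow> 0 \<le> u \<bullet> y + v" "\<And>y. y \<in> K \<Longrightarrow> u \<bullet> y + v \<le> 1"
    "1 < u \<bullet> x + v"
proof -
  obtain a b where ab: "a \<bullet> x < b" "\<And>y. y \<in> K \<Longrightarrow> b < a \<bullet> y"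
    using separating_hyperplane_closed_point[of K x] assms compact_imp_closed by metis
  obtain B where B: "\<And>y. y \<in> C \<Longrightarrow> norm y \<le> B"
    using assms(4) bounded_iff by blast
  \<comment> \<open>By Cauchy-Schwarz, \<open>R\<close> bounds \<open>a \<bullet> y - b\<close> on
    \<open>C\<close>. The summand 1 makes it positive; the absolute value covers a negative
    \<open>B\<close>, possible when \<open>C\<close> is empty.\<close>
  define R where "R = norm a * \<bar>B\<bar> + \<bar>b\<bar> + 1"
  have "0 \<le> norm a * \<bar>B\<bar>" by simp
  then have R: "0 < R" unfolding R_def by linarith
  define u v where "u = (- 1 / R) *\<^sub>R a" and "v = b / R + 1"
  have uv: "u \<bullet> y + v = 1 + (b - a \<bullet> y) / R" for y
    by (simp add: u_def v_def diff_divide_distrib)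
  show thesis
  proof
    fix y assume "y \<in> C"
    have "a \<bullet> y \<le> norm a * norm y" by (rule norm_cauchy_schwarz)
    also have "\<dots> \<le> norm a * \<bar>B\<bar>"
      using B[OF \<open>y \<in> C\<close>] by (intro mult_left_mono) auto
    finally have "- R \<le> b - a \<bullet> y" unfolding R_def by linarith
    then have "- 1 \<le> (b - a \<bullet> y) / R" using R by (simp add: pos_le_divide_eq)
    then show "0 \<le> u \<bullet> y + v" unfolding uv by linarith
  next
    fix y assume "y \<in> K"
    then show "u \<bullet> y + v \<le> 1"
      unfolding uv using ab(2)[of y] R by (simp add: divide_nonpos_pos)
  next
    show "1 < u \<bullet> x + v"
      unfolding uv using ab(1) R by simp
  qed
qed

lemma finite_affine_separation:
  fixes K :: "'a::euclidean_space set"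
  assumes "convex K" "compact K" "bounded C" "compact D" "D \<inter> K = {}"
  obtains F :: "('a \<times> real) set" and \<delta> :: real where "finite F" "0 < \<delta>"
    "\<And>u v y. (u, v) \<in> F \<Longrightarrow> y \<in> C \<Longrightarrow> 0 \<le> u \<bullet> y + v"
    "\<And>u v y. (u, v) \<in> F \<Longrightarrow> y \<in> K \<Longrightarrow> u \<bullet> y + v \<le> 1"
    "\<And>x. x \<in> D \<Longrightarrow> \<exists>(u, v)\<in>F. 1 + \<delta> \<le> u \<bullet> x + v"
proof -
  \<comment> \<open>The third component records a margin, so that a finite subcover yields a uniform
    \<delta> as a minimum.\<close>
  define T :: "('a \<times> real \<times> real) set" where
    "T = {(u, v, d). (\<forall>y\<in>C. 0 \<le> u \<bullet> y + v) \<and> (\<forall>y\<in>K. u \<bullet> y + v \<le> 1) \<and> 0 < d}"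
  define U :: "'a \<times> real \<times> real \<Rightarrow> 'a set" where
    "U = (\<lambda>(u, v, d). {x. 1 + d < u \<bullet> x + v})"
  have "open (U p)" for p
    unfolding U_def by (cases p) (auto intro!: open_Collect_less continuous_intros)
  moreover have "D \<subseteq> (\<Union>p\<in>T. U p)"
  proof
    fix x assume "x \<in> D"
    then have "x \<notin> K" using assms(5) by blast
    then obtain u v where uv: "\<And>y. y \<in> C \<Longrightarrow> 0 \<le> u \<bullet> y + v"
      "\<And>y. y \<in> K \<Longrightarrow> u \<bullet> y + v \<le> 1" "1 < u \<bullet> x + v"
      using affine_separation[OF assms(1,2) _ assms(3)] by metis
    \<comment> \<open>Half of the excess over 1 leaves the inequality defining \<open>U\<close>
      strict.\<close>
    then have "(u, v, (u \<bullet> x + v - 1) / 2) \<in> T" "x \<in> U (u, v, (u \<bullet> x + v - 1) / 2)"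
      by (auto simp: T_def U_def field_simps)
    then show "x \<in> (\<Union>p\<in>T. U p)" by blast
  qed
  ultimately obtain T' where T': "T' \<subseteq> T" "finite T'" "D \<subseteq> (\<Union>p\<in>T'. U p)"
    using compactE_image[OF assms(4), of T U] by metis
  define F where "F = (\<lambda>(u, v, d). (u, v)) ` T'"
  \<comment> \<open>Inserting 1 keeps the minimum meaningful when \<open>T'\<close> is empty, which
    can happen if \<open>D\<close> is.\<close>
  define \<delta> where "\<delta> = Min (insert 1 ((\<lambda>(u, v, d). d) ` T'))"
  have le: "\<delta> \<le> d" if "(u, v, d) \<in> T'" for u v d
  proof -
    have "d \<in> (\<lambda>(u, v, d). d) ` T'" using that by force
    then show ?thesis using T'(2) by (simp add: \<delta>_def)
  qed
  show thesis
  proof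
    show "finite F" using T'(2) by (simp add: F_def)
    show "0 < \<delta>" using T'(1,2) by (auto simp: \<delta>_def T_def)
  next
    fix u v y assume uv: "(u, v) \<in> F"
    then obtain d where "(u, v, d) \<in> T" using T'(1) by (auto simp: F_def)
    then show "y \<in> C \<Longrightarrow> 0 \<le> u \<bullet> y + v" "y \<in> K \<Longrightarrow> u \<bullet> y + v \<le> 1"
      by (auto simp: T_def)
  next
    fix x assume "x \<in> D"
    then obtain u v d where p: "(u, v, d) \<in> T'" "1 + d < u \<bullet> x + v"
      using T'(3) by (auto simp: U_def)
    then have "(u, v) \<in> F" unfolding F_def by force
    then show "\<exists>(u, v)\<in>F. 1 + \<delta> \<le> u \<bullet> x + v" using p(2) le[OF p(1)] by force
  qed
qed

text \<open>The power function is convex on the nonnegative half-line, into which the affine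
  function maps \<open>C\<close>. For odd \<open>m\<close> > 1 it is not convex on the whole line,
  whence the sign condition.\<close>

lemma convex_on_affine_power:
  fixes u :: "'a::real_inner"
  assumes "convex C" "\<And>y. y \<in> C \<Longrightarrow> 0 \<le> u \<bullet> y + v"
  shows "convex_on C (\<lambda>x. (u \<bullet> x + v) ^ m)"
proof
  have pow: "convex_on {0::real..} (\<lambda>x. x ^ m)"
    using convex_power_odd convex_power_even convex_on_subset
    by (cases "even m") (auto intro: convex_on_subset[OF convex_power_even])
  fix t :: real and x y assume t: "0 < t" "t < 1" and xy: "x \<in> C" "y \<in> C"
  have "u \<bullet> ((1 - t) *\<^sub>R x + t *\<^sub>R y) + v = (1 - t) * (u \<bullet> x + v) + t * (u \<bullet> y + v)"
    by (simp add: inner_add_right algebra_simps)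
  then show "(u \<bullet> ((1 - t) *\<^sub>R x + t *\<^sub>R y) + v) ^ m
      \<le> (1 - t) * (u \<bullet> x + v) ^ m + t * (u \<bullet> y + v) ^ m"
    using convex_onD[OF pow, of t "u \<bullet> x + v" "u \<bullet> y + v"] t xy assms(2) by simp
qed (use assms in simp)

lemma convex_on_finite_sum:
  assumes "finite A" "convex C" "\<And>a. a \<in> A \<Longrightarrow> convex_on C (f a)"
  shows "convex_on C (\<lambda>x. \<Sum>a\<in>A. f a x)"
  using assms by (induction A rule: finite_induct) (auto simp: convex_on_const)

text \<open>The first supremum runs over zeros since K \<subseteq> M; nonemptiness makes pointwise
  bounds pass to the suprema.\<close>

lemma hausdorff_dist_le:
  assumes "K \<noteq> {}" "K \<subseteq> M" "0 \<le> \<epsilon>" "\<And>y. y \<in> M \<Longrightarrow> infdist y K \<le> \<epsilon>"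
  shows "hausdorff_dist K M \<le> \<epsilon>"
  unfolding hausdorff_dist_def
proof (rule max.boundedI)
  show "(SUP x\<in>K. infdist x M) \<le> \<epsilon>"
    using assms(1-3) by (intro cSUP_least) (auto simp: subset_iff)
  show "(SUP y\<in>M. infdist y K) \<le> \<epsilon>"
    using assms by (intro cSUP_least) auto
qed

theorem theorem3p6:
  fixes K C :: "(real ^ 'n) set"
  assumes "convex_body K" and "convex_body C" and "K \<subseteq> interior C"
  shows "\<forall>\<epsilon>>0. \<exists>m\<ge>1. \<exists>K\<^sub>m. convex_body K\<^sub>m \<and> K\<^sub>m \<subseteq> C
           \<and> determined_by_moments m C K\<^sub>m \<and> hausdorff_dist K K\<^sub>m \<le> \<epsilon>"
proof (intro allI impI)
  fix \<epsilon> :: real assume \<epsilon>: "0 < \<epsilon>"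
  have K: "convex K" "compact K" and C: "convex C" "compact C"
    using assms(1,2) by (auto simp: convex_body_def)
  have KC: "K \<subseteq> C" using assms(3) interior_subset by blast
  obtain x0 where x0: "x0 \<in> interior K" using assms(1) by (auto simp: convex_body_def)
  \<comment> \<open>The non-strict inequality makes \<open>D\<close> closed, hence compact; points
    of \<open>C\<close> outside it are already close enough to \<open>K\<close>.\<close>
  define D where "D = C \<inter> {x. \<epsilon> \<le> infdist x K}"
  have "compact D"
    unfolding D_def using C(2)
    by (intro compact_Int_closed closed_Collect_le continuous_intros)
  moreover have "D \<inter> K = {}" using \<epsilon> by (auto simp: D_def)
  ultimately obtain F :: "((real ^ 'n) \<times> real) set" and \<delta> where F: "finite F" "0 < \<delta>"
    "\<And>u v y. (u, v) \<in> F \<Longrightarrow> y \<in> C \<Longrightarrow> 0 \<le> u \<bullet> y + v"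
    "\<And>u v y. (u, v) \<in> F \<Longrightarrow> y \<in> K \<Longrightarrow> u \<bullet> y + v \<le> 1"
    "\<And>x. x \<in> D \<Longrightarrow> \<exists>(u, v)\<in>F. 1 + \<delta> \<le> u \<bullet> x + v"
    using finite_affine_separation[OF K compact_imp_bounded[OF C(2)]] by metis
  \<comment> \<open>On \<open>K\<close> the sum of powers is at most \<open>k\<close>, so the
    threshold \<open>k + 1\<close> leaves room for \<open>g\<close> \<ge> 1 there. The exponent is
    chosen so that a single power exceeds this threshold at every point of \<open>D\<close>.\<close>
  define k where "k = real (card F)"
  obtain m where m: "k + 1 < (1 + \<delta>) ^ m"
    using real_arch_pow[of "1 + \<delta>"] F(2) by auto
  have "m \<noteq> 0" using m by (cases m) (auto simp: k_def)
  define g where "g x = k + 1 - (\<Sum>(u, v)\<in>F. (u \<bullet> x + v) ^ m)" for x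
  define M where "M = {x\<in>C. 0 \<le> g x}"
  have poly: "poly_deg_le m g"
    unfolding g_def using F(1)
    by (intro poly_deg_le_diff poly_deg_le_const poly_deg_le_sum)
      (auto intro: poly_deg_le_affine_power)
  have "convex_on C (\<lambda>x. (\<Sum>(u, v)\<in>F. (u \<bullet> x + v) ^ m) + (- (k + 1)))"
    using F(1,3) C(1)
    by (intro convex_on_add convex_on_finite_sum)
      (auto intro: convex_on_affine_power simp: convex_on_const)
  then have conc: "concave_on C g"
    unfolding concave_on_def g_def by (simp add: algebra_simps)
  have gK: "1 \<le> g x" if "x \<in> K" for x
  proof -
    have "(\<Sum>(u, v)\<in>F. (u \<bullet> x + v) ^ m) \<le> (\<Sum>p\<in>F. 1)"
      using F(3,4) that KC by (intro sum_mono) (auto intro!: power_le_one)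
    then show ?thesis by (simp add: g_def k_def)
  qed
  have KM: "K \<subseteq> M" using KC gK by (force simp: M_def)
  have far: "infdist y K \<le> \<epsilon>" if y: "y \<in> M" for y
  proof (rule ccontr)
    assume "\<not> infdist y K \<le> \<epsilon>"
    then obtain u v where uv: "(u, v) \<in> F" "1 + \<delta> \<le> u \<bullet> y + v"
      using F(5)[of y] y by (auto simp: D_def M_def)
    \<comment> \<open>One large summand suffices, since the others are nonnegative on
      \<open>C\<close>.\<close>
    have "(1 + \<delta>) ^ m \<le> (u \<bullet> y + v) ^ m"
      using uv(2) F(2) by (intro power_mono) auto
    also have "\<dots> \<le> (\<Sum>(u, v)\<in>F. (u \<bullet> y + v) ^ m)"
      using member_le_sum[of "(u, v)" F "\<lambda>(u, v). (u \<bullet> y + v) ^ m"] uv(1) F(1,3) y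
      by (auto simp: M_def)
    finally show False using m y by (simp add: M_def g_def)
  qed
  have x0M: "x0 \<in> interior M" using x0 KM interior_mono by blast
  have "0 < g x0" using x0 interior_subset gK[of x0] by force
  then have "determined_by_moments m C M"
    unfolding M_def using x0M
    by (intro superlevel_determined_by_moments[OF assms(2) poly conc]) (auto simp: M_def)
  moreover have "convex_body M"
    unfolding M_def using x0M
    by (intro convex_body_superlevel assms(2) conc poly_deg_le_continuous[OF poly])
      (auto simp: M_def)
  moreover have "hausdorff_dist K M \<le> \<epsilon>"
    using hausdorff_dist_le[OF _ KM _ far] x0 interior_subset \<epsilon> by fastforce
  ultimately show "\<exists>m\<ge>1. \<exists>K\<^sub>m. convex_body K\<^sub>m \<and> K\<^sub>m \<subseteq> C
      \<and> determined_by_moments m C K\<^sub>m \<and> hausdorff_dist K K\<^sub>m \<le> \<epsilon>"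
    using \<open>m \<noteq> 0\<close> by (intro exI[of _ m] conjI exI[of _ M]) (auto simp: M_def)
qed

end
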